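(* Let $G$ be a finitely generated, residually finite group of stable subexponential growth. Then for every finite generating set $X$ of $G$ one has $\mathrm{cr}_X(G)>0$ if and only if $G$ is virtually abelian. (In particular, if $G$ is not virtually abelian, then $\mathrm{cr}_X(G)=0$.)
   Context: For a group $G$ with finite generating set $X$, $\mathbb{B}_{G,X}(n)$ is the ball of radius $n$ about the identity for the word length over $X\cup X^{-1}$, and $C_{G,X}(n)$ is the set of conjugacy classes of $G$ having a representative in $\mathbb{B}_{G,X}(n)$. The conjugacy ratio is $\mathrm{cr}_X(G)=\limsup_{n\to\infty}\frac{|C_{G,X}(n)|}{|\mathbb{B}_{G,X}(n)|}$. The group $G$ with finite generating set $X$ is of stable subexponential growth if $\lim_{n\to\infty}\frac{|\mathbb{B}_{G,X}(n+1)|}{|\mathbb{B}_{G,X}(n)|}=1$. This condition is understood with respect to the generating set $X$ used in the conjugacy ratio, i.e. the claim is for every finite generating set $X$ for which the condition holds. *)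

theory Defs
  imports Complex_Main "HOL-Library.Extended_Real" "HOL-Algebra.Generated_Groups"
begin

definition finite_index :: "('a, 'b) monoid_scheme \<Rightarrow> 'a set \<Rightarrow> bool" where
  "finite_index G H \<longleftrightarrow> subgroup H G \<and> finite (rcosets\<^bsub>G\<^esub> H)"

definition virtually_abelian :: "('a, 'b) monoid_scheme \<Rightarrow> bool" where
  "virtually_abelian G \<longleftrightarrow> (\<exists>H. finite_index G H \<and> comm_group (G\<lparr>carrier := H\<rparr>))"

definition residually_finite :: "('a, 'b) monoid_scheme \<Rightarrow> bool" where
  "residually_finite G \<longleftrightarrow>
     (\<forall>g \<in> carrier G. g \<noteq> \<one>\<^bsub>G\<^esub> \<longrightarrow> (\<exists>N. N \<lhd> G \<and> finite_index G N \<and> g \<notin> N))"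

definition words_over :: "('a, 'b) monoid_scheme \<Rightarrow> 'a set \<Rightarrow> 'a list set" where
  "words_over G X = lists (X \<union> (\<lambda>x. inv\<^bsub>G\<^esub> x) ` X)"

definition word_value :: "('a, 'b) monoid_scheme \<Rightarrow> 'a list \<Rightarrow> 'a" where
  "word_value G w = foldr (\<lambda>x y. x \<otimes>\<^bsub>G\<^esub> y) w \<one>\<^bsub>G\<^esub>"

text \<open>Meaningful only for elements of the subgroup generated by \<open>X\<close>; for any other
  element no word exists and \<open>LEAST\<close> is unspecified. It is used below only for generating
  sets \<open>X\<close>.\<close>

definition word_length :: "('a, 'b) monoid_scheme \<Rightarrow> 'a set \<Rightarrow> 'a \<Rightarrow> nat" where
  "word_length G X g = (LEAST k. \<exists>w \<in> words_over G X. word_value G w = g \<and> length w = k)"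

definition word_ball :: "('a, 'b) monoid_scheme \<Rightarrow> 'a set \<Rightarrow> nat \<Rightarrow> 'a set" where
  "word_ball G X n = {g \<in> carrier G. word_length G X g \<le> n}"

definition conjugacy_class :: "('a, 'b) monoid_scheme \<Rightarrow> 'a \<Rightarrow> 'a set" where
  "conjugacy_class G g = {h \<otimes>\<^bsub>G\<^esub> g \<otimes>\<^bsub>G\<^esub> inv\<^bsub>G\<^esub> h | h. h \<in> carrier G}"

definition conjugacy_classes :: "('a, 'b) monoid_scheme \<Rightarrow> 'a set set" where
  "conjugacy_classes G = conjugacy_class G ` carrier G"

definition conjugacy_ball :: "('a, 'b) monoid_scheme \<Rightarrow> 'a set \<Rightarrow> nat \<Rightarrow> 'a set set" where
  "conjugacy_ball G X n = {K \<in> conjugacy_classes G. K \<inter> word_ball G X n \<noteq> {}}"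

text \<open>The limsup is taken in the complete lattice of extended reals.\<close>

definition conjugacy_ratio :: "('a, 'b) monoid_scheme \<Rightarrow> 'a set \<Rightarrow> ereal" where
  "conjugacy_ratio G X =
     limsup (\<lambda>n. ereal (real (card (conjugacy_ball G X n)) / real (card (word_ball G X n))))"

definition stable_subexponential_growth :: "('a, 'b) monoid_scheme \<Rightarrow> 'a set \<Rightarrow> bool" where
  "stable_subexponential_growth G X \<longleftrightarrow>
     (\<lambda>n. real (card (word_ball G X (Suc n))) / real (card (word_ball G X n))) \<longlonglongrightarrow> 1"

end

theory Submission
  imports Defs "HOL-Algebra.Group_Action"
begin

text \<open>Fix a normal subgroup \<open>N\<close> of finite index. Up to conjugation by elements of bounded length,
  all classes in the ball of radius \<open>n\<close> over a given class of \<open>G/N\<close> meet one coset of \<open>N\<close>, and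
  translation by bounded coset representatives together with stable subexponential growth shows
  that each coset occupies asymptotically at most a fraction \<open>1/|G/N|\<close> of the balls. Hence the
  conjugacy ratio is at most \<open>k(G/N)/|G/N|\<close>, the commuting probability of \<open>G/N\<close>. By Gallagher's
  inequality, commuting probabilities are submultiplicative in extensions, and for a nonabelian
  finite group they are at most \<open>3/4\<close> (the optimal \<open>5/8\<close> is not required). If \<open>G\<close> is not virtually
  abelian, \<open>N\<close> contains a nontrivial commutator, which residual finiteness excludes from a
  smaller finite-index normal subgroup \<open>M\<close>; so \<open>N/M\<close> is nonabelian, and iterating drives the bound
  to zero. Conversely, if \<open>H\<close> is abelian of index \<open>d\<close>, classes of elements of \<open>H\<close> have at most \<open>d\<close>
  elements, whence the conjugacy ratio is at least \<open>1/d\<^sup>2\<close>.\<close>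

section \<open>Commuting pairs in finite groups and Gallagher's inequality\<close>

text \<open>\<open>K\<close> may be any subset, so that pairs in a kernel are counted inside the
  ambient group.\<close>

definition commuting_pairs :: "('a, 'b) monoid_scheme \<Rightarrow> 'a set \<Rightarrow> ('a \<times> 'a) set" where
  "commuting_pairs G K = (SIGMA x:K. {y \<in> K. x \<otimes>\<^bsub>G\<^esub> y = y \<otimes>\<^bsub>G\<^esub> x})"

lemma card_commuting_pairs:
  "finite K \<Longrightarrow> card (commuting_pairs G K) = (\<Sum>x\<in>K. card {y \<in> K. x \<otimes>\<^bsub>G\<^esub> y = y \<otimes>\<^bsub>G\<^esub> x})"
  unfolding commuting_pairs_def by (subst card_SigmaI) auto

text \<open>A translate of \<open>H\<close> by an element outside \<open>H\<close> has the same size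
  as \<open>H\<close> and is disjoint from it.\<close>

lemma (in group) card_proper_subgroup:
  assumes "finite (carrier G)" "subgroup H G" "H \<noteq> carrier G"
  shows "2 * card H \<le> card (carrier G)"
proof -
  have sub: "H \<subseteq> carrier G" using assms(2) by (rule subgroup.subset)
  then obtain g where g: "g \<in> carrier G" "g \<notin> H" using assms(3) by blast
  have "(\<lambda>h. g \<otimes> h) ` H \<subseteq> carrier G - H"
  proof safe
    fix h assume h: "h \<in> H"
    then show "g \<otimes> h \<in> carrier G" using g sub by auto
    assume "g \<otimes> h \<in> H"
    then have "g \<otimes> h \<otimes> inv h \<in> H"
      using h assms(2) by (simp add: subgroup.m_closed subgroup.m_inv_closed)
    then show False using g h sub by (simp add: m_assoc subsetD)
  qed
  moreover have "inj_on (\<lambda>h. g \<otimes> h) H"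
    using g sub by (auto simp: inj_on_def subset_iff)
  ultimately have "card H \<le> card (carrier G - H)"
    using assms(1) by (meson card_inj_on_le finite_Diff)
  then show ?thesis
    using card_Diff_subset[of H "carrier G"] assms(1) sub finite_subset card_mono by fastforce
qed

lemma (in group) subgroup_centralizer:
  assumes "x \<in> carrier G"
  shows "subgroup {y \<in> carrier G. x \<otimes> y = y \<otimes> x} G"
proof (rule subgroupI)
  fix y assume "y \<in> {y \<in> carrier G. x \<otimes> y = y \<otimes> x}"
  then have y: "y \<in> carrier G" and c: "x \<otimes> y = y \<otimes> x" by auto
  have "inv y \<otimes> (x \<otimes> y) \<otimes> inv y = inv y \<otimes> (y \<otimes> x) \<otimes> inv y" using c by simp
  then have "inv y \<otimes> x = x \<otimes> inv y"
    using y assms by (metis inv_closed inv_solve_left inv_solve_right m_assoc m_closed)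
  then show "inv y \<in> {y \<in> carrier G. x \<otimes> y = y \<otimes> x}" using y by simp
next
  fix y z assume "y \<in> {y \<in> carrier G. x \<otimes> y = y \<otimes> x}" "z \<in> {y \<in> carrier G. x \<otimes> y = y \<otimes> x}"
  then show "y \<otimes> z \<in> {y \<in> carrier G. x \<otimes> y = y \<otimes> x}"
    using assms by (auto simp: m_assoc) (metis m_assoc)
qed (use assms in \<open>auto intro: exI[of _ \<one>]\<close>)

text \<open>A noncentral element has a centralizer of at most half the group. Central elements all
  lie in the centralizer of \<open>a\<close>, which is proper because of \<open>b\<close> and so is
  itself at most half. Averaging 1/2 and 1 with weights 1/2 gives 3/4.\<close>

lemma (in group) card_commuting_pairs_nonabelian:
  assumes fin: "finite (carrier G)"
    and nc: "a \<in> carrier G" "b \<in> carrier G" "a \<otimes> b \<noteq> b \<otimes> a"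
  shows "4 * card (commuting_pairs G (carrier G)) \<le> 3 * (card (carrier G))\<^sup>2"
proof -
  define n where "n = card (carrier G)"
  define C where "C x = {y \<in> carrier G. x \<otimes> y = y \<otimes> x}" for x
  have sub: "subgroup (C x) G" if "x \<in> carrier G" for x
    unfolding C_def using that by (rule subgroup_centralizer)
  \<comment> \<open>If \<open>x\<close> is central it commutes with \<open>a\<close>, so granting
    the full size on all of \<open>C a\<close> covers every exceptional \<open>x\<close>. Everything
    is doubled to avoid halves.\<close>
  have half: "2 * card (C x) \<le> n + (if x \<in> C a then n else 0)" if "x \<in> carrier G" for x
  proof (cases "C x = carrier G")
    case True
    then have "a \<in> C x" using nc by simp
    then have "x \<in> C a" using that by (simp add: C_def)
    then show ?thesis using True by (simp add: n_def)
  next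
    case False
    then show ?thesis using card_proper_subgroup[OF fin sub[OF that]] by (simp add: n_def)
  qed
  have Ca: "C a \<subseteq> carrier G" "C a \<noteq> carrier G" using nc by (auto simp: C_def)
  have "2 * card (commuting_pairs G (carrier G)) = (\<Sum>x\<in>carrier G. 2 * card (C x))"
    by (simp add: card_commuting_pairs fin C_def sum_distrib_left)
  also have "\<dots> \<le> (\<Sum>x\<in>carrier G. n + (if x \<in> C a then n else 0))"
    by (intro sum_mono half)
  also have "\<dots> = n * n + card (C a) * n"
    using Ca fin by (simp add: sum.distrib n_def sum.If_cases Int_absorb1)
  finally have "4 * card (commuting_pairs G (carrier G)) \<le> 2 * (n * n) + (2 * card (C a)) * n"
    by simp
  also have "\<dots> \<le> 2 * (n * n) + n * n"
    using card_proper_subgroup[OF fin sub Ca(2)] nc by (simp add: n_def)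
  finally show ?thesis by (simp add: n_def power2_eq_square)
qed

text \<open>A fibre of \<open>h\<close> inside a centralizer is empty or a coset of the centralizer in the kernel;
  this is the heart of Gallagher's inequality below.\<close>

lemma (in group_hom) card_centralizer_fibre:
  assumes fin: "finite (carrier G)" and y: "y \<in> carrier G"
  shows "card {x \<in> carrier G. h x = s \<and> y \<otimes> x = x \<otimes> y} \<le> card {x \<in> kernel G H h. y \<otimes> x = x \<otimes> y}"
    (is "card ?A \<le> card ?B")
proof (cases "?A = {}")
  case True
  then show ?thesis by (metis card.empty le0)
next
  case False
  then obtain z where z: "z \<in> carrier G" "h z = s" "y \<otimes> z = z \<otimes> y" by blast
  have "(\<lambda>x. x \<otimes> inv z) ` ?A \<subseteq> ?B"
  proof safe
    fix x assume x: "x \<in> carrier G" "s = h x" "y \<otimes> x = x \<otimes> y"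
    show "x \<otimes> inv z \<in> kernel G H h"
      using x z by (simp add: kernel_def)
    have C: "subgroup {u \<in> carrier G. y \<otimes> u = u \<otimes> y} G"
      using y by (rule G.subgroup_centralizer)
    have "x \<otimes> inv z \<in> {u \<in> carrier G. y \<otimes> u = u \<otimes> y}"
      using x z by (intro subgroup.m_closed[OF C] subgroup.m_inv_closed[OF C]) auto
    then show "y \<otimes> (x \<otimes> inv z) = x \<otimes> inv z \<otimes> y" by simp
  qed
  moreover have "inj_on (\<lambda>x. x \<otimes> inv z) ?A"
    using z by (auto simp: inj_on_def)
  moreover have "finite ?B" using fin by (auto simp: kernel_def)
  ultimately show ?thesis by (meson card_inj_on_le)
qed

text \<open>Gallagher's inequality before division by the squared orders. Commuting pairs have
  commuting images. Over a fixed pair of images the fibre bound is used twice: first for the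
  partners \<open>y\<close> of a given \<open>x\<close>, then, with the roles exchanged, for
  \<open>x\<close> itself.\<close>

lemma (in group_hom) card_commuting_pairs_le:
  assumes fin: "finite (carrier G)" and surj: "h ` carrier G = carrier H"
  shows "card (commuting_pairs G (carrier G)) \<le>
    card (commuting_pairs H (carrier H)) * card (commuting_pairs G (kernel G H h))"
proof -
  define K where "K = kernel G H h"
  define CK where "CK x = {y \<in> K. x \<otimes> y = y \<otimes> x}" for x
  define CH where "CH s = {t \<in> carrier H. s \<otimes>\<^bsub>H\<^esub> t = t \<otimes>\<^bsub>H\<^esub> s}" for s
  have K: "K \<subseteq> carrier G" "finite K" using fin by (auto simp: K_def kernel_def)
  have finH: "finite (carrier H)" using fin surj by (metis finite_imageI)
  have cent: "card {y \<in> carrier G. x \<otimes> y = y \<otimes> x} \<le> card (CH (h x)) * card (CK x)"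
    if x: "x \<in> carrier G" for x
  proof -
    \<comment> \<open>Every \<open>y\<close> commuting with \<open>x\<close> lies over an element
      commuting with \<open>h x\<close>, so the centralizer splits into fibres indexed by
      \<open>CH (h x)\<close>.\<close>
    have "{y \<in> carrier G. x \<otimes> y = y \<otimes> x}
        = (\<Union>s\<in>CH (h x). {y \<in> carrier G. h y = s \<and> x \<otimes> y = y \<otimes> x})"
      using x by (auto simp: CH_def) (metis hom_mult)
    also have "card \<dots> \<le> (\<Sum>s\<in>CH (h x). card {y \<in> carrier G. h y = s \<and> x \<otimes> y = y \<otimes> x})"
      using finH by (intro card_UN_le) (auto simp: CH_def)
    also have "\<dots> \<le> (\<Sum>s\<in>CH (h x). card (CK x))"
      using card_centralizer_fibre[OF fin x] by (intro sum_mono) (simp add: CK_def K_def)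
    finally show ?thesis by simp
  qed
  have fibre: "(\<Sum>x | x \<in> carrier G \<and> h x = s. card (CK x)) \<le> card (commuting_pairs G K)" for s
  proof -
    have "(\<Sum>x | x \<in> carrier G \<and> h x = s. card (CK x))
        = card (SIGMA x:{x \<in> carrier G. h x = s}. CK x)"
      using fin K by (subst card_SigmaI) (auto simp: CK_def)
    \<comment> \<open>Counting the same pairs by their kernel component makes the inner set a fibre
      of a centralizer, to which the fibre bound applies again.\<close>
    also have "\<dots> = card (SIGMA y:K. {x \<in> carrier G. h x = s \<and> y \<otimes> x = x \<otimes> y})"
      by (rule bij_betw_same_card[of prod.swap]) (rule bij_betw_byWitness[of _ prod.swap], auto simp: CK_def)
    also have "\<dots> = (\<Sum>y\<in>K. card {x \<in> carrier G. h x = s \<and> y \<otimes> x = x \<otimes> y})"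
      using fin K by (subst card_SigmaI) auto
    also have "\<dots> \<le> (\<Sum>y\<in>K. card (CK y))"
      unfolding CK_def using K by (intro sum_mono) (auto simp: K_def intro!: card_centralizer_fibre[OF fin])
    finally show ?thesis using K by (simp add: card_commuting_pairs CK_def)
  qed
  have "card (commuting_pairs G (carrier G)) \<le> (\<Sum>x\<in>carrier G. card (CH (h x)) * card (CK x))"
    using fin by (auto simp: card_commuting_pairs intro!: sum_mono cent)
  also have "\<dots> = (\<Sum>s\<in>carrier H. \<Sum>x | x \<in> carrier G \<and> h x = s. card (CH (h x)) * card (CK x))"
    using fin finH by (subst sum.group) auto
  also have "\<dots> = (\<Sum>s\<in>carrier H. card (CH s) * (\<Sum>x | x \<in> carrier G \<and> h x = s. card (CK x)))"
    by (simp add: sum_distrib_left)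
  also have "\<dots> \<le> (\<Sum>s\<in>carrier H. card (CH s) * card (commuting_pairs G K))"
    by (intro sum_mono mult_left_mono fibre) auto
  finally show ?thesis
    using finH by (simp add: card_commuting_pairs CH_def K_def sum_distrib_right)
qed

section \<open>Class numbers and commuting probability\<close>

text \<open>Burnside's lemma for the conjugation action: orbits are conjugacy classes and the fixed
  points of \<open>g\<close> form its centralizer.\<close>

lemma (in group) card_conjugacy_classes:
  assumes "finite (carrier G)"
  shows "card (conjugacy_classes G) * card (carrier G) = card (commuting_pairs G (carrier G))"
proof -
  define \<phi> where "\<phi> = (\<lambda>g. \<lambda>h\<in>carrier G. g \<otimes> h \<otimes> inv g)"
  interpret group_action G "carrier G" \<phi>
    unfolding \<phi>_def by (rule action_by_conjugation)
  have "orbit G \<phi> x = conjugacy_class G x" if "x \<in> carrier G" for x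
    using that by (simp add: orbit_def conjugacy_class_def \<phi>_def)
  then have orb: "orbits G (carrier G) \<phi> = conjugacy_classes G"
    by (auto simp: orbits_def conjugacy_classes_def)
  have inv: "invariants (carrier G) \<phi> g = {y \<in> carrier G. g \<otimes> y = y \<otimes> g}"
    if "g \<in> carrier G" for g
    using that by (auto simp: invariants_def \<phi>_def) (metis inv_solve_right m_closed)+
  show ?thesis
    using burnside[OF assms assms] assms
    by (simp add: orb inv order_def card_commuting_pairs)
qed

definition commuting_probability :: "('a, 'b) monoid_scheme \<Rightarrow> real" where
  "commuting_probability G =
     real (card (commuting_pairs G (carrier G))) / (real (card (carrier G)))\<^sup>2"

text \<open>In Gallagher's inequality the kernel contributes its own commuting probability, at most
  3/4 because \<open>a\<close> and \<open>b\<close> do not commute.\<close>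

lemma (in group_hom) commuting_probability_le:
  assumes fin: "finite (carrier G)" and surj: "h ` carrier G = carrier H"
    and nc: "a \<in> kernel G H h" "b \<in> kernel G H h" "a \<otimes> b \<noteq> b \<otimes> a"
  shows "commuting_probability G \<le> 3 / 4 * commuting_probability H"
proof -
  define K where "K = kernel G H h"
  define q where "q = card (carrier H)"
  define k where "k = card K"
  have K: "subgroup K G" unfolding K_def by (rule subgroup_kernel)
  have finK: "finite K" using fin by (auto simp: K_def kernel_def)
  interpret K: group "G\<lparr>carrier := K\<rparr>"
    using K by (rule subgroup.subgroup_is_group[OF _ G.is_group])
  have "4 * card (commuting_pairs (G\<lparr>carrier := K\<rparr>) K) \<le> 3 * k\<^sup>2"
    using K.card_commuting_pairs_nonabelian[of a b] nc finK by (simp add: K_def k_def)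
  then have nonab: "4 * card (commuting_pairs G K) \<le> 3 * k\<^sup>2"
    by (simp add: commuting_pairs_def)
  \<comment> \<open>The first isomorphism theorem gives the index of \<open>K\<close>; Lagrange's
    theorem then factors the order of \<open>G\<close>, so that the normalizations match.\<close>
  have "bij_betw (\<lambda>X. the_elem (h ` X)) (carrier (G Mod K)) (carrier H)"
    using FactGroup_iso_set[OF surj] by (simp add: iso_def K_def)
  then have "card (rcosets K) = q"
    by (simp add: bij_betw_same_card q_def FactGroup_def)
  then have card: "card (carrier G) = q * k"
    using G.lagrange[OF K] by (simp add: order_def k_def)
  have pos: "q > 0" "k > 0"
    using card fin G.one_closed by (metis card_gt_0_iff empty_iff nat_0_less_mult_iff)+
  have "4 * card (commuting_pairs G (carrier G)) \<le> card (commuting_pairs H (carrier H)) * (4 * card (commuting_pairs G K))"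
    using card_commuting_pairs_le[OF fin surj] by (simp add: K_def)
  also have "\<dots> \<le> card (commuting_pairs H (carrier H)) * (3 * k\<^sup>2)"
    using nonab by (rule mult_left_mono) simp
  finally have "real (4 * card (commuting_pairs G (carrier G)))
      \<le> real (card (commuting_pairs H (carrier H)) * (3 * k\<^sup>2))"
    by (rule of_nat_mono)
  then show ?thesis
    using pos unfolding commuting_probability_def card q_def[symmetric]
    by (simp add: divide_simps power_mult_distrib)
qed

lemma commuting_probability_le_1:
  assumes "finite (carrier G)"
  shows "commuting_probability G \<le> 1"
proof -
  have "card (commuting_pairs G (carrier G)) \<le> card (carrier G \<times> carrier G)"
    using assms by (intro card_mono) (auto simp: commuting_pairs_def)
  then have "real (card (commuting_pairs G (carrier G))) \<le> (real (card (carrier G)))\<^sup>2"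
    by (simp add: card_cartesian_product power2_eq_square flip: of_nat_mult)
  then show ?thesis
    by (cases "card (carrier G) = 0") (auto simp: commuting_probability_def divide_le_eq)
qed

section \<open>Finite quotients of residually finite groups\<close>

text \<open>A coset of the intersection is the intersection of a coset of \<open>M\<close> with a
  coset of \<open>N\<close>, so finitely many pairs determine all of them.\<close>

lemma finite_index_Int:
  assumes "group G" "finite_index G M" "finite_index G N"
  shows "finite_index G (M \<inter> N)"
proof -
  interpret group G by fact
  have sM: "subgroup M G" and sN: "subgroup N G" using assms by (auto simp: finite_index_def)
  have MN: "subgroup (M \<inter> N) G" using sM sN by (rule subgroups_Inter_pair)
  have "rcosets\<^bsub>G\<^esub> (M \<inter> N) \<subseteq> (\<lambda>(A, B). A \<inter> B) ` ((rcosets\<^bsub>G\<^esub> M) \<times> (rcosets\<^bsub>G\<^esub> N))"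
  proof
    fix c assume "c \<in> rcosets\<^bsub>G\<^esub> (M \<inter> N)"
    then obtain x where x: "x \<in> carrier G" "c = (M \<inter> N) #>\<^bsub>G\<^esub> x" by (auto simp: RCOSETS_def)
    have "c = (M #>\<^bsub>G\<^esub> x) \<inter> (N #>\<^bsub>G\<^esub> x)"
      using x subgroup.subset[OF sM] subgroup.subset[OF sN] by (auto simp: r_coset_def subset_iff)
    moreover have "M #>\<^bsub>G\<^esub> x \<in> rcosets\<^bsub>G\<^esub> M" "N #>\<^bsub>G\<^esub> x \<in> rcosets\<^bsub>G\<^esub> N"
      using x by (auto simp: RCOSETS_def)
    ultimately show "c \<in> (\<lambda>(A, B). A \<inter> B) ` ((rcosets\<^bsub>G\<^esub> M) \<times> (rcosets\<^bsub>G\<^esub> N))" by auto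
  qed
  moreover have "finite ((rcosets\<^bsub>G\<^esub> M) \<times> (rcosets\<^bsub>G\<^esub> N))"
    using assms by (auto simp: finite_index_def)
  ultimately show ?thesis
    using MN by (metis finite_imageI finite_subset finite_index_def)
qed

lemma commuting_probability_quotient:
  assumes G: "group G" and rf: "residually_finite G" and nva: "\<not> virtually_abelian G"
    and N: "N \<lhd> G" "finite_index G N"
  shows "\<exists>M. M \<lhd> G \<and> finite_index G M \<and>
           commuting_probability (G Mod M) \<le> 3 / 4 * commuting_probability (G Mod N)"
proof -
  interpret group G by fact
  interpret N: normal N G by fact
  interpret GN: group "G\<lparr>carrier := N\<rparr>"
    using N.subgroup_axioms by (rule subgroup.subgroup_is_group[OF _ is_group])
  have "\<not> comm_group (G\<lparr>carrier := N\<rparr>)"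
    using nva N by (auto simp: virtually_abelian_def)
  then obtain a b where ab: "a \<in> N" "b \<in> N" "a \<otimes>\<^bsub>G\<^esub> b \<noteq> b \<otimes>\<^bsub>G\<^esub> a"
    using GN.group_comm_groupI by auto
  then have ab': "a \<in> carrier G" "b \<in> carrier G" using N.subset by auto
  \<comment> \<open>Modulo a normal subgroup, \<open>a\<close> and \<open>b\<close> commute exactly
    when it contains this commutator; residual finiteness supplies one that does not.\<close>
  define c where "c = a \<otimes>\<^bsub>G\<^esub> b \<otimes>\<^bsub>G\<^esub> inv\<^bsub>G\<^esub> (b \<otimes>\<^bsub>G\<^esub> a)"
  have "c \<in> carrier G" using ab' by (simp add: c_def)
  moreover have "c \<noteq> \<one>\<^bsub>G\<^esub>"
    using ab(3) ab' inv_solve_right'[of "\<one>\<^bsub>G\<^esub>" "a \<otimes>\<^bsub>G\<^esub> b" "b \<otimes>\<^bsub>G\<^esub> a"]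
    by (simp add: c_def del: inv_mult_group)
  ultimately obtain L where L: "L \<lhd> G" "finite_index G L" "c \<notin> L"
    using rf by (auto simp: residually_finite_def)
  \<comment> \<open>Intersecting with \<open>N\<close> makes \<open>G Mod N\<close> a quotient of
    \<open>G Mod M\<close>, while \<open>c\<close> stays outside.\<close>
  define M where "M = N \<inter> L"
  have M: "M \<lhd> G" "finite_index G M" "c \<notin> M"
    using N L G by (auto simp: M_def normal_subgroup_intersect finite_index_Int)
  interpret M: normal M G by fact
  have MN: "M \<subseteq> N" by (simp add: M_def)
  \<comment> \<open>The projection to \<open>G Mod N\<close> is constant on cosets of
    \<open>M\<close>, hence factors through \<open>G Mod M\<close>. The images of \<open>a\<close>
    and \<open>b\<close> lie in the kernel of the induced map.\<close>
  have eq: "N #>\<^bsub>G\<^esub> x = N #>\<^bsub>G\<^esub> y"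
    if "x \<in> carrier G" "y \<in> carrier G" "M #>\<^bsub>G\<^esub> x = M #>\<^bsub>G\<^esub> y" for x y
  proof -
    have "y \<in> M #>\<^bsub>G\<^esub> x" using that M.subgroup_axioms by (simp add: rcos_self)
    then have "y \<in> N #>\<^bsub>G\<^esub> x" using MN by (auto simp: r_coset_def)
    then show ?thesis using that N.subgroup_axioms by (intro repr_independence)
  qed
  obtain h where h: "h \<in> hom (G Mod M) (G Mod N)" "\<And>x. x \<in> carrier G \<Longrightarrow> h (M #>\<^bsub>G\<^esub> x) = N #>\<^bsub>G\<^esub> x"
    using FactGroup_universal[OF N.r_coset_hom_Mod M(1) eq] by blast
  interpret h: group_hom "G Mod M" "G Mod N" h
    by (intro group_hom.intro group_hom_axioms.intro h M.factorgroup_is_group N.factorgroup_is_group)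
  have ker: "M #>\<^bsub>G\<^esub> x \<in> kernel (G Mod M) (G Mod N) h" if "x \<in> N" for x
    using that N.subset h(2) N.rcos_const[OF G] by (auto simp: kernel_def carrier_FactGroup)
  have "(M #>\<^bsub>G\<^esub> a) \<otimes>\<^bsub>G Mod M\<^esub> (M #>\<^bsub>G\<^esub> b) \<noteq> (M #>\<^bsub>G\<^esub> b) \<otimes>\<^bsub>G Mod M\<^esub> (M #>\<^bsub>G\<^esub> a)"
  proof
    assume "(M #>\<^bsub>G\<^esub> a) \<otimes>\<^bsub>G Mod M\<^esub> (M #>\<^bsub>G\<^esub> b) = (M #>\<^bsub>G\<^esub> b) \<otimes>\<^bsub>G Mod M\<^esub> (M #>\<^bsub>G\<^esub> a)"
    then have "M #>\<^bsub>G\<^esub> (b \<otimes>\<^bsub>G\<^esub> a) = M #>\<^bsub>G\<^esub> (a \<otimes>\<^bsub>G\<^esub> b)" using ab' by (simp add: M.rcos_sum)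
    then have "a \<otimes>\<^bsub>G\<^esub> b \<in> M #>\<^bsub>G\<^esub> (b \<otimes>\<^bsub>G\<^esub> a)"
      using ab' M.subgroup_axioms by (simp add: rcos_self)
    then have "c \<in> M" unfolding c_def using ab' G by (intro M.rcos_module_imp) auto
    then show False using M by simp
  qed
  moreover have "finite (carrier (G Mod M))" using M by (simp add: finite_index_def FactGroup_def)
  moreover have "h ` carrier (G Mod M) = carrier (G Mod N)"
    using h(2) by (force simp: carrier_FactGroup image_image)
  ultimately have "commuting_probability (G Mod M) \<le> 3 / 4 * commuting_probability (G Mod N)"
    using ker ab by (intro h.commuting_probability_le) auto
  then show ?thesis using M by blast
qed

lemma small_commuting_probability:
  assumes G: "group G" and rf: "residually_finite G" and nva: "\<not> virtually_abelian G"
  shows "\<exists>N. N \<lhd> G \<and> finite_index G N \<and> commuting_probability (G Mod N) \<le> (3 / 4) ^ i"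
proof (induction i)
  case 0
  interpret group G by fact
  \<comment> \<open>The iteration starts at the trivial quotient, where the bound 1
    suffices.\<close>
  have "carrier G \<lhd> G" by (simp add: normal_invI subgroup_self)
  moreover have "finite_index G (carrier G)"
  proof -
    have "rcosets\<^bsub>G\<^esub> (carrier G) \<subseteq> {carrier G}"
      using coset_join2[OF _ subgroup_self] by (auto simp: RCOSETS_def)
    then show ?thesis by (auto simp: finite_index_def subgroup_self intro: finite_subset)
  qed
  ultimately show ?case
    by (auto intro!: exI[of _ "carrier G"] commuting_probability_le_1 simp: finite_index_def FactGroup_def)
next
  case (Suc i)
  then obtain N where N: "N \<lhd> G" "finite_index G N" "commuting_probability (G Mod N) \<le> (3 / 4) ^ i"
    by blast
  obtain M where "M \<lhd> G" "finite_index G M"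
    "commuting_probability (G Mod M) \<le> 3 / 4 * commuting_probability (G Mod N)"
    using commuting_probability_quotient[OF G rf nva N(1,2)] by blast
  with N(3) show ?case by (intro exI[of _ M]) auto
qed

section \<open>Cosets and conjugacy classes\<close>

lemma (in group) rcos_eq_if_mem:
  assumes "subgroup H G" "c \<in> rcosets H" "x \<in> c"
  shows "c = H #> x" "x \<in> carrier G"
proof -
  obtain y where y: "y \<in> carrier G" "c = H #> y" using assms(2) by (auto simp: RCOSETS_def)
  then show "c = H #> x" using assms y repr_independence[of x H y] by simp
  show "x \<in> carrier G" using y assms by (meson subgroup.elemrcos_carrier is_group)
qed

lemma (in group) conjugacy_class_conj:
  assumes "g \<in> carrier G" "h \<in> carrier G"
  shows "conjugacy_class G (h \<otimes> g \<otimes> inv h) = conjugacy_class G g"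
proof (intro equalityI subsetI)
  fix x assume "x \<in> conjugacy_class G (h \<otimes> g \<otimes> inv h)"
  then obtain k where k: "k \<in> carrier G" "x = k \<otimes> (h \<otimes> g \<otimes> inv h) \<otimes> inv k"
    by (auto simp: conjugacy_class_def)
  then have "x = (k \<otimes> h) \<otimes> g \<otimes> inv (k \<otimes> h)"
    using assms by (simp add: m_assoc inv_mult_group)
  then show "x \<in> conjugacy_class G g" using assms k by (auto simp: conjugacy_class_def)
next
  fix x assume "x \<in> conjugacy_class G g"
  then obtain k where k: "k \<in> carrier G" "x = k \<otimes> g \<otimes> inv k"
    by (auto simp: conjugacy_class_def)
  have "(k \<otimes> inv h) \<otimes> (h \<otimes> g \<otimes> inv h) \<otimes> inv (k \<otimes> inv h) = k \<otimes> (inv h \<otimes> (h \<otimes> (g \<otimes> (inv h \<otimes> (h \<otimes> inv k)))))"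
    using assms k by (simp add: m_assoc inv_mult_group)
  also have "\<dots> = x" using assms k by (simp add: m_assoc flip: m_assoc[of "inv h" h])
  finally show "x \<in> conjugacy_class G (h \<otimes> g \<otimes> inv h)"
    using assms k by (auto simp: conjugacy_class_def intro!: exI[of _ "k \<otimes> inv h"])
qed

lemma (in group) mem_conjugacy_class: "g \<in> carrier G \<Longrightarrow> g \<in> conjugacy_class G g"
  by (auto simp: conjugacy_class_def intro!: exI[of _ \<one>])

lemma (in group) conjugacy_class_eq_if_mem:
  assumes "K \<in> conjugacy_classes G" "g \<in> K"
  shows "K = conjugacy_class G g"
proof -
  obtain x where x: "x \<in> carrier G" "K = conjugacy_class G x"
    using assms by (auto simp: conjugacy_classes_def)
  moreover obtain h where "h \<in> carrier G" "g = h \<otimes> x \<otimes> inv h"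
    using assms x by (auto simp: conjugacy_class_def)
  ultimately show ?thesis using conjugacy_class_conj by simp
qed

section \<open>Word balls in a finitely generated group\<close>

locale finitely_generated_group = group G for G (structure) +
  fixes X
  assumes finite_generators: "finite X"
    and generators_subset: "X \<subseteq> carrier G"
    and generate_eq: "generate G X = carrier G"
begin

abbreviation ball :: "nat \<Rightarrow> 'a set" where "ball \<equiv> word_ball G X"

lemma word_value_closed: "w \<in> words_over G X \<Longrightarrow> word_value G w \<in> carrier G"
  unfolding words_over_def word_value_def
  by (induction w rule: lists.induct) (use generators_subset in auto)

lemma word_value_append:
  assumes "v \<in> words_over G X" "w \<in> words_over G X"
  shows "word_value G (v @ w) = word_value G v \<otimes> word_value G w"
  using assms(1) unfolding words_over_def
proof (induction v rule: lists.induct)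
  case Nil
  then show ?case using word_value_closed[OF assms(2)] by (simp add: word_value_def)
next
  case (Cons a v)
  then have "a \<in> carrier G" "word_value G v \<in> carrier G"
    using generators_subset word_value_closed by (auto simp: words_over_def)
  then show ?case
    using Cons word_value_closed[OF assms(2)] by (simp add: word_value_def m_assoc)
qed

lemma ex_word:
  assumes "g \<in> carrier G"
  shows "\<exists>w\<in>words_over G X. word_value G w = g"
proof -
  have "g \<in> generate G X" using assms generate_eq by simp
  then show ?thesis
  proof induction
    case one
    then show ?case by (auto simp: words_over_def word_value_def intro!: bexI[of _ "[]"])
  next
    case (incl h)
    then show ?case
      using generators_subset by (intro bexI[of _ "[h]"]) (auto simp: words_over_def word_value_def)
  next
    case (inv h)
    then show ?case
      using generators_subset by (intro bexI[of _ "[inv h]"]) (auto simp: words_over_def word_value_def)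
  next
    case (eng g h)
    then obtain v w where "v \<in> words_over G X" "w \<in> words_over G X"
      "word_value G v = g" "word_value G w = h" by blast
    then show ?case
      using word_value_append by (intro bexI[of _ "v @ w"]) (auto simp: words_over_def)
  qed
qed

text \<open>Since \<open>X\<close> generates, every element has a word and the \<open>LEAST\<close>
  in the word length is attained. Balls can then be handled through words alone.\<close>

lemma ball_eq: "ball n = word_value G ` {w \<in> words_over G X. length w \<le> n}"
proof (intro equalityI subsetI)
  fix g assume "g \<in> ball n"
  then have g: "g \<in> carrier G" and le: "word_length G X g \<le> n"
    by (auto simp: word_ball_def)
  have "\<exists>k. \<exists>w\<in>words_over G X. word_value G w = g \<and> length w = k"
    using ex_word[OF g] by blast
  from LeastI_ex[OF this] obtain w where
    "w \<in> words_over G X" "word_value G w = g" "length w = word_length G X g"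
    unfolding word_length_def by blast
  then show "g \<in> word_value G ` {w \<in> words_over G X. length w \<le> n}"
    using le by auto
next
  fix g assume "g \<in> word_value G ` {w \<in> words_over G X. length w \<le> n}"
  then obtain w where w: "w \<in> words_over G X" "length w \<le> n" "g = word_value G w" by blast
  have "word_length G X g \<le> length w"
    unfolding word_length_def by (rule Least_le) (use w in blast)
  then show "g \<in> ball n" using w word_value_closed by (auto simp: word_ball_def)
qed

lemma finite_ball: "finite (ball n)"
proof -
  have "{w \<in> words_over G X. length w \<le> n} = {w. set w \<subseteq> X \<union> (\<lambda>x. inv x) ` X \<and> length w \<le> n}"
    by (auto simp: words_over_def)
  then show ?thesis
    using finite_generators by (simp add: ball_eq finite_lists_length_le)
qed

lemma ball_subset: "ball n \<subseteq> carrier G"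
  by (auto simp: word_ball_def)

lemma ball_mono: "m \<le> n \<Longrightarrow> ball m \<subseteq> ball n"
  by (auto simp: word_ball_def)

lemma one_in_ball: "\<one> \<in> ball n"
  unfolding ball_eq by (rule image_eqI[of _ _ "[]"]) (auto simp: word_value_def words_over_def)

lemma card_ball_pos: "card (ball n) > 0"
  using finite_ball one_in_ball by (auto simp: card_gt_0_iff)

lemma ball_mult:
  assumes "g \<in> ball m" "h \<in> ball n"
  shows "g \<otimes> h \<in> ball (m + n)"
proof -
  obtain v w where "v \<in> words_over G X" "length v \<le> m" "g = word_value G v"
    "w \<in> words_over G X" "length w \<le> n" "h = word_value G w"
    using assms by (auto simp: ball_eq)
  then show ?thesis
    unfolding ball_eq using word_value_append
    by (intro image_eqI[of _ _ "v @ w"]) (auto simp: words_over_def)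
qed

lemma finite_subset_ball:
  assumes "finite A" "A \<subseteq> carrier G"
  shows "\<exists>m. A \<subseteq> ball m"
  using assms
proof (induction A rule: finite_induct)
  case empty
  then show ?case by simp
next
  case (insert g A)
  then obtain m where "A \<subseteq> ball m" by auto
  moreover have "g \<in> ball (word_length G X g)" using insert by (simp add: word_ball_def)
  ultimately have "insert g A \<subseteq> ball (max m (word_length G X g))"
    using ball_mono by (meson insert_subset max.cobounded1 max.cobounded2 subset_iff)
  then show ?case ..
qed

section \<open>Balls and cosets of finite-index subgroups\<close>

text \<open>There are finitely many cosets, so one radius serves all representatives. It is the
  source of the bounded shifts of radius in the counting lemmas.\<close>

lemma coset_representatives:
  assumes "finite_index G H"
  obtains r m where "\<And>c. c \<in> rcosets H \<Longrightarrow> r c \<in> c"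
    "\<And>c. c \<in> rcosets H \<Longrightarrow> r c \<in> ball m" "\<And>c. c \<in> rcosets H \<Longrightarrow> inv (r c) \<in> ball m"
proof -
  have H: "subgroup H G" "finite (rcosets H)" using assms by (auto simp: finite_index_def)
  define r where "r c = (SOME x. x \<in> c)" for c :: "'a set"
  have r: "r c \<in> c" if "c \<in> rcosets H" for c
    using subgroup.rcosets_non_empty[OF H(1) that] by (auto simp: r_def some_in_eq)
  have rG: "r c \<in> carrier G" if "c \<in> rcosets H" for c
    using r[OF that] that subgroup.rcosets_carrier[OF H(1) is_group] by blast
  \<comment> \<open>The inverses are put into the finite set as well, so symmetry of balls need not
    be shown.\<close>
  let ?A = "r ` (rcosets H) \<union> (\<lambda>c. inv (r c)) ` (rcosets H)"
  have "finite ?A" "?A \<subseteq> carrier G" using H(2) rG by auto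
  then obtain m where "?A \<subseteq> ball m" by (metis finite_subset_ball)
  then show thesis using r by (intro that[of r m]) auto
qed

text \<open>Each \<open>g\<close> is an element of \<open>H\<close> times the representative of its
  coset, and dividing by the latter raises the length by at most \<open>m\<close>.\<close>

lemma card_ball_le_subgroup:
  assumes "finite_index G H"
  obtains m where "\<And>n. card (ball n) \<le> card (rcosets H) * card (H \<inter> ball (n + m))"
proof -
  have H: "subgroup H G" "finite (rcosets H)" using assms by (auto simp: finite_index_def)
  obtain r m where r: "\<And>c. c \<in> rcosets H \<Longrightarrow> r c \<in> c"
    "\<And>c. c \<in> rcosets H \<Longrightarrow> inv (r c) \<in> ball m"
    using coset_representatives[OF assms] by metis
  have "card (ball n) \<le> card (rcosets H) * card (H \<inter> ball (n + m))" for n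
  proof -
    have "ball n \<subseteq> (\<lambda>(c, x). x \<otimes> r c) ` ((rcosets H) \<times> (H \<inter> ball (n + m)))"
    proof
      fix g assume g: "g \<in> ball n"
      then have gG: "g \<in> carrier G" using ball_subset by blast
      define c where "c = H #> g"
      have c: "c \<in> rcosets H" using gG by (auto simp: c_def RCOSETS_def)
      have rG: "r c \<in> carrier G" and "c = H #> r c"
        using rcos_eq_if_mem[OF H(1) c r(1)[OF c]] by auto
      then have "g \<otimes> inv (r c) \<in> H"
        using gG rcos_self[OF gG H(1)] subgroup.rcos_module_imp[OF H(1) is_group] by (simp add: c_def)
      moreover have "g \<otimes> inv (r c) \<in> ball (n + m)" using g r(2)[OF c] by (rule ball_mult)
      moreover have "g = g \<otimes> inv (r c) \<otimes> r c" using gG rG by (simp add: m_assoc)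
      ultimately show "g \<in> (\<lambda>(c, x). x \<otimes> r c) ` ((rcosets H) \<times> (H \<inter> ball (n + m)))"
        using c by (intro image_eqI[of _ _ "(c, g \<otimes> inv (r c))"]) auto
    qed
    then have "card (ball n) \<le> card ((rcosets H) \<times> (H \<inter> ball (n + m)))"
      using H(2) finite_ball by (intro surj_card_le) auto
    then show ?thesis by (simp add: card_cartesian_product)
  qed
  then show thesis by (rule that)
qed

text \<open>The translates of the part of \<open>H\<close> in the ball by the representatives are
  disjoint, of equal size, and fit into a slightly larger ball.\<close>

lemma card_subgroup_le_ball:
  assumes "finite_index G H"
  obtains m where "\<And>n. card (rcosets H) * card (H \<inter> ball n) \<le> card (ball (n + m))"
proof -
  have H: "subgroup H G" "finite (rcosets H)" using assms by (auto simp: finite_index_def)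
  obtain r m where r: "\<And>c. c \<in> rcosets H \<Longrightarrow> r c \<in> c"
    "\<And>c. c \<in> rcosets H \<Longrightarrow> r c \<in> ball m"
    using coset_representatives[OF assms] by metis
  have "card (rcosets H) * card (H \<inter> ball n) \<le> card (ball (n + m))" for n
  proof -
    have "inj_on (\<lambda>(c, x). x \<otimes> r c) ((rcosets H) \<times> (H \<inter> ball n))"
    proof (rule inj_onI, clarify)
      fix c x d y
      assume c: "c \<in> rcosets H" and d: "d \<in> rcosets H" and xy: "x \<in> H" "y \<in> H"
        and eq: "x \<otimes> r c = y \<otimes> r d"
      have rc: "c = H #> r c" "r c \<in> carrier G" and rd: "d = H #> r d" "r d \<in> carrier G"
        using rcos_eq_if_mem[OF H(1)] c d r(1) by auto
      have xyG: "x \<in> carrier G" "y \<in> carrier G" using xy H(1) by (auto simp: subgroup.mem_carrier)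
      \<comment> \<open>The product lies in the coset whose representative was used, so it
        determines that coset and then the factor from \<open>H\<close>.\<close>
      have "c = H #> (x \<otimes> r c)"
        using rc xy H(1) by (intro rcos_eq_if_mem[OF H(1) c]) (auto simp: r_coset_def)
      moreover have "d = H #> (y \<otimes> r d)"
        using rd xy H(1) by (intro rcos_eq_if_mem[OF H(1) d]) (auto simp: r_coset_def)
      ultimately have "c = d" using eq by simp
      then show "c = d \<and> x = y" using eq rc rd xyG by simp
    qed
    moreover have "(\<lambda>(c, x). x \<otimes> r c) ` ((rcosets H) \<times> (H \<inter> ball n)) \<subseteq> ball (n + m)"
      using r ball_mult by auto
    ultimately have "card ((rcosets H) \<times> (H \<inter> ball n)) \<le> card (ball (n + m))"
      using finite_ball by (meson card_inj_on_le)
    then show ?thesis by (simp add: card_cartesian_product)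
  qed
  then show thesis by (rule that)
qed

section \<open>Counting conjugacy classes that meet a ball\<close>

lemma conjugacy_ball_eq: "conjugacy_ball G X n = conjugacy_class G ` ball n"
proof (intro equalityI subsetI)
  fix K assume "K \<in> conjugacy_ball G X n"
  then show "K \<in> conjugacy_class G ` ball n"
    using conjugacy_class_eq_if_mem by (auto simp: conjugacy_ball_def)
next
  fix K assume "K \<in> conjugacy_class G ` ball n"
  then show "K \<in> conjugacy_ball G X n"
    using mem_conjugacy_class ball_subset by (force simp: conjugacy_ball_def conjugacy_classes_def)
qed

lemma finite_conjugacy_ball: "finite (conjugacy_ball G X n)"
  using finite_ball by (simp add: conjugacy_ball_eq)

text \<open>A bounded conjugation moves \<open>g\<close> into a coset fixed in advance for its class
  in the quotient; dividing by a bounded element of that coset lands in \<open>N\<close>. The class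
  of \<open>g\<close> is recovered from the quotient class and this element of
  \<open>N\<close>.\<close>

lemma card_conjugacy_ball_le:
  assumes N: "N \<lhd> G" and fi: "finite_index G N"
  obtains m where "\<And>n. card (conjugacy_ball G X n)
    \<le> card (conjugacy_classes (G Mod N)) * card (N \<inter> ball (n + m))"
proof -
  interpret N: normal N G by fact
  interpret Q: group "G Mod N" by (rule N.factorgroup_is_group)
  have carQ: "carrier (G Mod N) = rcosets N" by (simp add: FactGroup_def)
  have finQ: "finite (rcosets N)" using fi by (simp add: finite_index_def)
  obtain r m where r: "\<And>c. c \<in> rcosets N \<Longrightarrow> r c \<in> c" "\<And>c. c \<in> rcosets N \<Longrightarrow> r c \<in> ball m"
    "\<And>c. c \<in> rcosets N \<Longrightarrow> inv (r c) \<in> ball m"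
    using coset_representatives[OF fi] by metis
  have rcos: "N #> r c = c" "r c \<in> carrier G" if "c \<in> rcosets N" for c
    using rcos_eq_if_mem[OF N.subgroup_axioms that r(1)[OF that]] by auto
  \<comment> \<open>\<open>s D\<close> is the coset singled out in the quotient class
    \<open>D\<close>, and \<open>a D\<close> its bounded representative.\<close>
  define s where "s D = (SOME c. c \<in> D)" for D :: "'a set set"
  define a where "a D = r (s D)" for D
  \<comment> \<open>Three elements of length at most \<open>m\<close> are spent: \<open>b\<close>
    and \<open>inv b\<close> for the conjugation and \<open>inv (a D)\<close> for the
    division.\<close>
  have "card (conjugacy_ball G X n)
      \<le> card (conjugacy_classes (G Mod N)) * card (N \<inter> ball (n + 3 * m))" for n
  proof -
    let ?P = "conjugacy_classes (G Mod N) \<times> (N \<inter> ball (n + 3 * m))"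
    have "conjugacy_ball G X n \<subseteq> (\<lambda>(D, x). conjugacy_class G (x \<otimes> a D)) ` ?P"
    proof
      fix K assume "K \<in> conjugacy_ball G X n"
      then obtain g where K: "K = conjugacy_class G g" and g: "g \<in> ball n"
        by (auto simp: conjugacy_ball_eq)
      then have gG: "g \<in> carrier G" using ball_subset by blast
      define D where "D = conjugacy_class (G Mod N) (N #> g)"
      have gQ: "N #> g \<in> carrier (G Mod N)" using gG by (auto simp: carrier_FactGroup)
      then have D: "D \<in> conjugacy_classes (G Mod N)" by (auto simp: D_def conjugacy_classes_def)
      have "N #> g \<in> D"
        unfolding D_def conjugacy_class_def using gQ by (auto intro!: exI[of _ "\<one>\<^bsub>G Mod N\<^esub>"] simp del: mult_FactGroup one_FactGroup)
      then have "s D \<in> D" unfolding s_def by (rule someI)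
      then obtain f where f: "f \<in> rcosets N" "s D = f \<otimes>\<^bsub>G Mod N\<^esub> (N #> g) \<otimes>\<^bsub>G Mod N\<^esub> inv\<^bsub>G Mod N\<^esub> f"
        by (auto simp: D_def conjugacy_class_def carQ)
      define b where "b = r f"
      have b: "b \<in> carrier G" "f = N #> b" "b \<in> ball m" "inv b \<in> ball m"
        using rcos[OF f(1)] r[OF f(1)] by (auto simp: b_def)
      define u where "u = b \<otimes> g \<otimes> inv b"
      have u: "u \<in> carrier G" using b gG by (simp add: u_def)
      have "inv\<^bsub>G Mod N\<^esub> f = N #> inv b"
        using N.inv_FactGroup[of f] f b by (simp add: carQ N.rcos_inv)
      then have sD: "s D = N #> u" using f b gG by (simp add: N.rcos_sum u_def)
      then have sD': "s D \<in> rcosets N" using u by (auto simp: RCOSETS_def)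
      have aD: "N #> a D = N #> u" "a D \<in> carrier G" "inv (a D) \<in> ball m"
        using rcos[OF sD'] r(3)[OF sD'] sD by (auto simp: a_def)
      define x where "x = u \<otimes> inv (a D)"
      have "u \<in> N #> a D" using aD u N.subgroup_axioms by (simp add: rcos_self)
      then have "x \<in> N" unfolding x_def using aD by (intro N.rcos_module_imp is_group)
      moreover have "x \<in> ball (m + n + m + m)"
        unfolding x_def u_def using b g aD by (intro ball_mult)
      moreover have "m + n + m + m = n + 3 * m" by simp
      ultimately have "x \<in> N \<inter> ball (n + 3 * m)" by (metis IntI)
      moreover have "x \<otimes> a D = u" using u aD by (simp add: x_def m_assoc)
      then have "K = conjugacy_class G (x \<otimes> a D)"
        using K gG b conjugacy_class_conj by (simp add: u_def)
      ultimately show "K \<in> (\<lambda>(D, x). conjugacy_class G (x \<otimes> a D)) ` ?P"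
        using D by (intro image_eqI[of _ _ "(D, x)"]) auto
    qed
    moreover have "finite ?P"
      using finQ finite_ball by (auto simp: conjugacy_classes_def carQ)
    ultimately have "card (conjugacy_ball G X n) \<le> card ?P" by (rule surj_card_le[rotated])
    then show ?thesis by (simp add: card_cartesian_product)
  qed
  then show thesis by (rule that)
qed

text \<open>Each of the \<open>k\<close> quotient classes costs one copy of \<open>N\<close> in a
  ball, and \<open>d\<close> such copies fit into a slightly larger ball.\<close>

lemma conjugacy_ball_ratio_le:
  assumes N: "N \<lhd> G" and fi: "finite_index G N"
  obtains m where "\<And>n. real (card (conjugacy_ball G X n))
    \<le> commuting_probability (G Mod N) * real (card (ball (n + m)))"
proof -
  interpret N: normal N G by fact
  interpret Q: group "G Mod N" by (rule N.factorgroup_is_group)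
  have carQ: "carrier (G Mod N) = rcosets N" by (simp add: FactGroup_def)
  have finQ: "finite (carrier (G Mod N))" using fi by (simp add: finite_index_def carQ)
  define d where "d = card (rcosets N)"
  define k where "k = card (conjugacy_classes (G Mod N))"
  have d: "d > 0" using finQ Q.one_closed by (auto simp: d_def card_gt_0_iff carQ)
  obtain m1 where m1: "\<And>n. card (conjugacy_ball G X n) \<le> k * card (N \<inter> ball (n + m1))"
    using card_conjugacy_ball_le[OF N fi] by (metis k_def)
  obtain m2 where m2: "\<And>n. d * card (N \<inter> ball n) \<le> card (ball (n + m2))"
    using card_subgroup_le_ball[OF fi] by (metis d_def)
  \<comment> \<open>By Burnside's lemma there are \<open>k * d\<close> commuting pairs in the
    quotient of order \<open>d\<close>.\<close>
  have cp: "commuting_probability (G Mod N) = real k / real d"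
    unfolding commuting_probability_def Q.card_conjugacy_classes[OF finQ, symmetric]
    using d by (simp add: power2_eq_square carQ flip: d_def k_def)
  have "real (card (conjugacy_ball G X n))
      \<le> commuting_probability (G Mod N) * real (card (ball (n + (m1 + m2))))" for n
  proof -
    have "d * card (conjugacy_ball G X n) \<le> k * (d * card (N \<inter> ball (n + m1)))"
      using mult_left_mono[OF m1[of n], of d] by (simp add: ac_simps)
    also have "\<dots> \<le> k * card (ball (n + (m1 + m2)))"
      using mult_left_mono[OF m2[of "n + m1"], of k] by (simp add: add.assoc)
    finally have "real (d * card (conjugacy_ball G X n)) \<le> real (k * card (ball (n + (m1 + m2))))"
      by (rule of_nat_mono)
    then show ?thesis using d by (simp add: cp field_simps)
  qed
  then show thesis by (rule that)
qed

text \<open>One factor of the index comes from passing from the ball to its part in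
  \<open>H\<close>, the other from the size of the classes of elements of \<open>H\<close>.\<close>

lemma card_ball_le_conjugacy_ball:
  assumes fi: "finite_index G H" and ab: "comm_group (G\<lparr>carrier := H\<rparr>)"
  obtains m where "\<And>n. card (ball n) \<le> (card (rcosets H))\<^sup>2 * card (conjugacy_ball G X (n + m))"
proof -
  have H: "subgroup H G" "finite (rcosets H)" using fi by (auto simp: finite_index_def)
  obtain r where r: "\<And>c. c \<in> rcosets H \<Longrightarrow> r c \<in> c"
    using coset_representatives[OF fi] by metis
  have comm: "x \<otimes> y = y \<otimes> x" if "x \<in> H" "y \<in> H" for x y
    using comm_monoid.m_comm[OF comm_group.axioms(1)[OF ab], of x y] that by simp
  have fin: "finite (conjugacy_class G x)" "card (conjugacy_class G x) \<le> card (rcosets H)" if x: "x \<in> H" for x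
  proof -
    have xG: "x \<in> carrier G" using x H(1) by (simp add: subgroup.mem_carrier)
    \<comment> \<open>As \<open>H\<close> centralizes \<open>x\<close>, the conjugate by
      \<open>h\<close> depends only on the coset \<open>H #> inv h\<close>: the factor
      \<open>z\<close> by which its representative differs from \<open>inv h\<close>
      cancels.\<close>
    have "conjugacy_class G x \<subseteq> (\<lambda>c. inv (r c) \<otimes> x \<otimes> r c) ` (rcosets H)"
    proof
      fix y assume "y \<in> conjugacy_class G x"
      then obtain h where h: "h \<in> carrier G" "y = h \<otimes> x \<otimes> inv h"
        by (auto simp: conjugacy_class_def)
      define c where "c = H #> inv h"
      have c: "c \<in> rcosets H" using h by (auto simp: c_def RCOSETS_def)
      obtain z where z: "z \<in> H" "r c = z \<otimes> inv h" using r[OF c] by (auto simp: c_def r_coset_def)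
      have zG: "z \<in> carrier G" using z H(1) by (simp add: subgroup.mem_carrier)
      have "inv (r c) \<otimes> x \<otimes> r c = h \<otimes> (inv z \<otimes> (x \<otimes> z)) \<otimes> inv h"
        using z zG h xG by (simp add: inv_mult_group m_assoc)
      also have "inv z \<otimes> (x \<otimes> z) = x"
        using comm[OF x z(1)] zG xG by (simp flip: m_assoc)
      finally show "y \<in> (\<lambda>c. inv (r c) \<otimes> x \<otimes> r c) ` (rcosets H)"
        using c h by (intro image_eqI[of _ _ c]) auto
    qed
    then show "finite (conjugacy_class G x)" "card (conjugacy_class G x) \<le> card (rcosets H)"
      using H(2) by (auto intro: finite_surj surj_card_le)
  qed
  have card_H: "card (H \<inter> ball n) \<le> card (rcosets H) * card (conjugacy_ball G X n)" for n
  proof -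
    let ?C = "conjugacy_class G ` (H \<inter> ball n)"
    have "H \<inter> ball n \<subseteq> \<Union> ?C" using mem_conjugacy_class ball_subset by blast
    then have "card (H \<inter> ball n) \<le> card (\<Union> ?C)"
      using fin(1) finite_ball by (intro card_mono) auto
    also have "\<dots> \<le> (\<Sum>K\<in>?C. card K)" using card_Union_le_sum_card .
    also have "\<dots> \<le> (\<Sum>K\<in>?C. card (rcosets H))" using fin(2) by (intro sum_mono) auto
    also have "\<dots> = card (rcosets H) * card ?C" by simp
    also have "\<dots> \<le> card (rcosets H) * card (conjugacy_ball G X n)"
      using finite_conjugacy_ball by (intro mult_left_mono card_mono) (auto simp: conjugacy_ball_eq)
    finally show ?thesis .
  qed
  obtain m where m: "\<And>n. card (ball n) \<le> card (rcosets H) * card (H \<inter> ball (n + m))"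
    using card_ball_le_subgroup[OF fi] by metis
  have "card (ball n) \<le> (card (rcosets H))\<^sup>2 * card (conjugacy_ball G X (n + m))" for n
    using order_trans[OF m mult_left_mono[OF card_H]]
    by (simp add: power2_eq_square mult.assoc)
  then show thesis by (rule that)
qed

section \<open>Asymptotics of the conjugacy ratio\<close>

text \<open>The quotient telescopes into \<open>m\<close> one-step quotients, each tending to 1.
  Thus a bounded shift of radius is harmless in the limit.\<close>

lemma ball_ratio_tendsto:
  assumes "stable_subexponential_growth G X"
  shows "(\<lambda>n. real (card (ball (n + m))) / real (card (ball n))) \<longlonglongrightarrow> 1"
proof (induction m)
  case 0
  then show ?case using card_ball_pos by (simp add: less_imp_neq[THEN not_sym])
next
  case (Suc m)
  have "(\<lambda>n. real (card (ball (Suc (n + m)))) / real (card (ball (n + m)))) \<longlonglongrightarrow> 1"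
    using LIMSEQ_ignore_initial_segment[of "\<lambda>n. real (card (ball (Suc n))) / real (card (ball n))" 1 m] assms
    by (simp add: stable_subexponential_growth_def)
  from tendsto_mult[OF this Suc] show ?case
    using card_ball_pos by (simp add: less_imp_neq[THEN not_sym])
qed

lemma conjugacy_ratio_le:
  assumes "stable_subexponential_growth G X" "N \<lhd> G" "finite_index G N"
  shows "conjugacy_ratio G X \<le> ereal (commuting_probability (G Mod N))"
proof -
  let ?p = "commuting_probability (G Mod N)"
  obtain m where m: "\<And>n. real (card (conjugacy_ball G X n)) \<le> ?p * real (card (ball (n + m)))"
    using conjugacy_ball_ratio_le[OF assms(2,3)] by metis
  have "conjugacy_ratio G X \<le> limsup (\<lambda>n. ereal (?p * (real (card (ball (n + m))) / real (card (ball n)))))"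
    unfolding conjugacy_ratio_def
  proof (intro Limsup_mono always_eventually allI)
    fix n
    show "ereal (real (card (conjugacy_ball G X n)) / real (card (ball n)))
        \<le> ereal (?p * (real (card (ball (n + m))) / real (card (ball n))))"
      using divide_right_mono[OF m[of n], of "real (card (ball n))"] by simp
  qed
  also have "\<dots> = ereal (?p * 1)"
    by (intro lim_imp_Limsup tendsto_intros ball_ratio_tendsto assms) simp
  finally show ?thesis by simp
qed

lemma conjugacy_ratio_nonneg: "0 \<le> conjugacy_ratio G X"
  unfolding conjugacy_ratio_def
  by (rule le_Limsup) (auto intro!: always_eventually)

lemma conjugacy_ratio_pos:
  assumes st: "stable_subexponential_growth G X" and va: "virtually_abelian G"
  shows "0 < conjugacy_ratio G X"
proof -
  obtain H where H: "finite_index G H" "comm_group (G\<lparr>carrier := H\<rparr>)"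
    using va by (auto simp: virtually_abelian_def)
  \<comment> \<open>This is the square of the index; the ratio will be bounded below by its
    inverse.\<close>
  define d where "d = (real (card (rcosets H)))\<^sup>2"
  obtain m where m: "\<And>n. card (ball n) \<le> (card (rcosets H))\<^sup>2 * card (conjugacy_ball G X (n + m))"
    using card_ball_le_conjugacy_ball[OF H] by metis
  have m': "real (card (ball n)) \<le> d * real (card (conjugacy_ball G X (n + m)))" for n
    using of_nat_mono[OF m[of n], where 'a = real] by (simp add: d_def)
  \<comment> \<open>A vanishing index would make the bound at radius 0 fail, since that ball
    contains the identity.\<close>
  have d: "d > 0" using m[of 0] card_ball_pos[of 0] by (simp add: d_def) (metis gr0I mult_zero_left not_le zero_power2)
  let ?f = "\<lambda>n. ereal (real (card (conjugacy_ball G X n)) / real (card (ball n)))"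
  have "(\<lambda>n. inverse d * inverse (real (card (ball (n + m))) / real (card (ball n)))) \<longlonglongrightarrow> inverse d * inverse 1"
    by (intro tendsto_intros ball_ratio_tendsto st) simp
  then have "ereal (inverse d) = limsup (\<lambda>n. ereal (inverse d * inverse (real (card (ball (n + m))) / real (card (ball n)))))"
    by (intro lim_imp_Limsup[symmetric] tendsto_intros) auto
  also have "\<dots> \<le> limsup (\<lambda>n. ?f (n + m))"
  proof (intro Limsup_mono always_eventually allI)
    fix n
    have "inverse d * real (card (ball n)) \<le> real (card (conjugacy_ball G X (n + m)))"
      using m'[of n] d by (simp add: field_simps)
    from divide_right_mono[OF this, of "real (card (ball (n + m)))"]
    show "ereal (inverse d * inverse (real (card (ball (n + m))) / real (card (ball n)))) \<le> ?f (n + m)"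
      by (simp add: divide_inverse ac_simps)
  qed
  \<comment> \<open>The shifted sequence is a subsequence, so its limsup is no larger.\<close>
  also have "\<dots> \<le> conjugacy_ratio G X"
    using limsup_subseq_mono[of "\<lambda>n. n + m" ?f]
    by (simp add: conjugacy_ratio_def comp_def strict_mono_def)
  finally show ?thesis using d by (auto intro: less_le_trans[of 0 "ereal (inverse d)"])
qed

end

theorem theorem3p7:
  fixes G :: "('a, 'b) monoid_scheme" and X :: "'a set"
  assumes "group G"
    and "residually_finite G"
    and "finite X" and "X \<subseteq> carrier G" and "generate G X = carrier G"
    and "stable_subexponential_growth G X"
  shows "(conjugacy_ratio G X > 0 \<longleftrightarrow> virtually_abelian G) \<and>
         (\<not> virtually_abelian G \<longrightarrow> conjugacy_ratio G X = 0)"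
proof -
  interpret finitely_generated_group G X
    using assms by (intro finitely_generated_group.intro finitely_generated_group_axioms.intro)
  have zero: "conjugacy_ratio G X = 0" if nva: "\<not> virtually_abelian G"
  proof (rule antisym)
    \<comment> \<open>The ratio does not depend on the chosen quotient, so the bounds for all
      \<open>i\<close> hold simultaneously and force it down to 0.\<close>
    have le: "conjugacy_ratio G X \<le> ereal ((3 / 4) ^ i)" for i
    proof -
      obtain N where "N \<lhd> G" "finite_index G N" "commuting_probability (G Mod N) \<le> (3 / 4) ^ i"
        using small_commuting_probability[OF assms(1,2) nva] by blast
      then show ?thesis using conjugacy_ratio_le[OF assms(6)] by (meson ereal_less_eq(3) order_trans)
    qed
    have "(\<lambda>i. ereal ((3 / 4) ^ i)) \<longlonglongrightarrow> ereal 0"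
      by (intro tendsto_intros LIMSEQ_power_zero) auto
    then show "conjugacy_ratio G X \<le> 0"
      using le by (intro LIMSEQ_le_const[of "\<lambda>i. ereal ((3 / 4) ^ i)"]) (auto simp: zero_ereal_def)
  qed (rule conjugacy_ratio_nonneg)
  then show ?thesis using conjugacy_ratio_pos[OF assms(6)] by (metis less_irrefl)
qed

end
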